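(* Let $G$ be a group and let $X$ be an infinite transitive $G$-space. For every $p\in X^*$, the following statements are equivalent: (i) $p$ is not isolated in $Gp$; (ii) there exists $q\in(G\setminus St(p))^*$ such that $qp=p$; (iii) there exists $\varepsilon\in(G\setminus St(p))^*$ such that $\varepsilon\varepsilon=\varepsilon$ and $\varepsilon p=p$.
   Context: $G$ and $X$ are endowed with the discrete topology; $\beta X$ is the Stone–Čech compactification of $X$, i.e. the set of ultrafilters on $X$ with base of open sets $\overline{A}=\{p\in\beta X: A\in p\}$, $A\subseteq X$; points of $X$ are identified with principal ultrafilters, $X^*=\beta X\setminus X$, and similarly $\beta G$, $G^*=\beta G\setminus G$. For $S\subseteq G$, $S^*=\{q\in G^*: S\in q\}$. $\beta G$ acts on $\beta X$ as follows: for $q\in\beta G$ and $p\in\beta X$, $qp$ is the ultrafilter on $X$ with base consisting of the sets $\bigcup_{g\in Q}gP_g$, where $Q\in q$ and $P_g\in p$ for each $g\in Q$. (For $g\in G$, $gp=\{gP:P\in p\}$, and $q\mapsto qp$ is the continuous extension to $\beta G$ of $g\mapsto gp$.) The multiplication on $\beta G$ is this same operation for $X=G$ with $G$ acting on itself by left multiplication; it makes $\beta G$ a compact right topological semigroup. $Gp=\{gp:g\in G\}$ is taken with the subspace topology from $\beta X$, and $St(p)=\{g\in G: gp=p\}$. *)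

theory Defs
  imports "HOL-Algebra.Group_Action" "HOL-Analysis.Abstract_Topology"
begin

text \<open>
  A (proper) filter on a set \<open>X\<close> is a family of subsets of \<open>X\<close>. The type constructor of filters in
  the library is not used because its members live on a whole type and may be improper.
\<close>

definition filter_on :: "'b set \<Rightarrow> 'b set set \<Rightarrow> bool" where
  "filter_on X p \<longleftrightarrow> p \<subseteq> Pow X \<and> X \<in> p \<and> {} \<notin> p \<and>
     (\<forall>A\<in>p. \<forall>B\<in>p. A \<inter> B \<in> p) \<and> (\<forall>A\<in>p. \<forall>B. A \<subseteq> B \<and> B \<subseteq> X \<longrightarrow> B \<in> p)"

definition ultrafilter_on :: "'b set \<Rightarrow> 'b set set \<Rightarrow> bool" where
  "ultrafilter_on X p \<longleftrightarrow> filter_on X p \<and> (\<forall>A\<subseteq>X. A \<in> p \<or> X - A \<in> p)"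

definition stone_cech :: "'b set \<Rightarrow> 'b set set set" where
  "stone_cech X = {p. ultrafilter_on X p}"

definition sc_cl :: "'b set \<Rightarrow> 'b set \<Rightarrow> 'b set set set" where
  "sc_cl X A = {p \<in> stone_cech X. A \<in> p}"

definition sc_topology :: "'b set \<Rightarrow> 'b set set topology" where
  "sc_topology X = topology (arbitrary union_of (\<lambda>U. \<exists>A\<subseteq>X. U = sc_cl X A))"

lemma sc_cl_Int:
  assumes "A \<subseteq> X" "B \<subseteq> X"
  shows "sc_cl X A \<inter> sc_cl X B = sc_cl X (A \<inter> B)"
proof -
  have "A \<inter> B \<in> p \<longleftrightarrow> A \<in> p \<and> B \<in> p" if "filter_on X p" for p
    using that assms unfolding filter_on_def by (meson Int_lower1 Int_lower2)
  then show ?thesis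
    unfolding sc_cl_def stone_cech_def ultrafilter_on_def by blast
qed

lemma openin_sc_topology:
  "openin (sc_topology X) = arbitrary union_of (\<lambda>U. \<exists>A\<subseteq>X. U = sc_cl X A)"
proof -
  have "istopology (arbitrary union_of (\<lambda>U. \<exists>A\<subseteq>X. U = sc_cl X A))"
  proof (rule istopology_base)
    fix S T
    assume "\<exists>A\<subseteq>X. S = sc_cl X A" "\<exists>A\<subseteq>X. T = sc_cl X A"
    then show "\<exists>A\<subseteq>X. S \<inter> T = sc_cl X A"
      using sc_cl_Int by (metis le_infI1)
  qed
  then show ?thesis
    unfolding sc_topology_def by (rule topology_inverse')
qed

lemma topspace_sc_topology: "topspace (sc_topology X) = stone_cech X"
proof -
  have "sc_cl X X = stone_cech X"
    by (auto simp: sc_cl_def stone_cech_def ultrafilter_on_def filter_on_def)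
  then have "openin (sc_topology X) (stone_cech X)"
    unfolding openin_sc_topology by (intro union_of_inc) (auto simp: arbitrary_def)
  moreover have "U \<subseteq> stone_cech X" if "openin (sc_topology X) U" for U
    using that unfolding openin_sc_topology union_of_def sc_cl_def by blast
  ultimately show ?thesis
    by (simp add: openin_subset subset_antisym)
qed

definition principal_uf :: "'b set \<Rightarrow> 'b \<Rightarrow> 'b set set" where
  "principal_uf X x = {A. A \<subseteq> X \<and> x \<in> A}"

definition sc_remainder :: "'b set \<Rightarrow> 'b set set set" where
  "sc_remainder X = stone_cech X - principal_uf X ` X"

definition sc_star :: "'b set \<Rightarrow> 'b set \<Rightarrow> 'b set set set" where
  "sc_star X S = {q \<in> sc_remainder X. S \<in> q}"

definition uf_translate :: "('a \<Rightarrow> 'b \<Rightarrow> 'b) \<Rightarrow> 'a \<Rightarrow> 'b set set \<Rightarrow> 'b set set" where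
  "uf_translate \<phi> g p = {\<phi> g ` P | P. P \<in> p}"

text \<open>The product \<open>qp\<close> is the filter on \<open>X\<close> generated by the base of sets
  \<open>\<Union>g\<in>Q. g P\<^sub>g\<close> with \<open>Q \<in> q\<close> and \<open>P\<^sub>g \<in> p\<close>.\<close>

definition uf_act ::
  "'b set \<Rightarrow> ('a \<Rightarrow> 'b \<Rightarrow> 'b) \<Rightarrow> 'a set set \<Rightarrow> 'b set set \<Rightarrow> 'b set set" where
  "uf_act X \<phi> q p =
     {A. A \<subseteq> X \<and> (\<exists>Q\<in>q. \<exists>P. (\<forall>g\<in>Q. P g \<in> p) \<and> (\<Union>g\<in>Q. \<phi> g ` P g) \<subseteq> A)}"

definition uf_mult :: "('a, 'm) monoid_scheme \<Rightarrow> 'a set set \<Rightarrow> 'a set set \<Rightarrow> 'a set set" where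
  "uf_mult G q r = uf_act (carrier G) (mult G) q r"

end

theory Submission
  imports Defs "HOL-Analysis.T1_Spaces"
begin

text \<open>
  Why the theorem holds. Since \<open>A \<in> qp\<close> iff \<open>A \<in> gp\<close> for \<open>q\<close>-almost all \<open>g\<close>, an ultrafilter
  \<open>q\<close> with \<open>qp = p\<close> that lives on \<open>G - St(p)\<close> supplies, in each neighbourhood of \<open>p\<close>, a
  translate \<open>gp \<noteq> p\<close>. Conversely, if every neighbourhood of \<open>p\<close> contains such a translate, then
  the sets \<open>{g \<in> G - St(p). A \<in> gp}\<close> with \<open>A \<in> p\<close> generate a filter, and \<open>qp = p\<close> for every
  ultrafilter \<open>q\<close> that extends it. This is the equivalence of (i) and (ii).

  For (ii) implies (iii), put \<open>S = {q \<in> \<beta>G. G - St(p) \<in> q, qp = p}\<close>. It is closed, because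
  \<open>q \<mapsto> qp\<close> is continuous, and nonempty by (ii). The point is that \<open>S\<close> is a subsemigroup,
  although \<open>G - St(p)\<close> need not be closed under multiplication. Indeed no \<open>r \<in> S\<close> contains a left
  coset of \<open>St(p)\<close>: on such a coset \<open>h \<mapsto> hp\<close> is constant, so its value would be \<open>rp = p\<close> and
  the coset would be \<open>St(p)\<close> itself, which \<open>r\<close> avoids (lemma \<open>fixing_uf_avoids_fibres\<close>).
  Therefore \<open>g\<inverse>(G - St(p)) \<in> r\<close> for every \<open>g \<in> G\<close>, and \<open>G - St(p) \<in> qr\<close> whatever \<open>q\<close> is.
  The Ellis--Numakura lemma gives an idempotent in \<open>S\<close>. The same remark on cosets shows that
  members of \<open>S\<close> are never principal, so that \<open>S\<close> lies in \<open>G\<^sup>*\<close>.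
\<close>

section \<open>Ultrafilters\<close>

lemma filter_onI:
  assumes "p \<subseteq> Pow X" "X \<in> p" "{} \<notin> p"
    and "\<And>A B. A \<in> p \<Longrightarrow> B \<in> p \<Longrightarrow> A \<inter> B \<in> p"
    and "\<And>A B. A \<in> p \<Longrightarrow> A \<subseteq> B \<Longrightarrow> B \<subseteq> X \<Longrightarrow> B \<in> p"
  shows "filter_on X p"
  using assms by (simp add: filter_on_def)

lemma filter_on_mono: "filter_on X p \<Longrightarrow> A \<in> p \<Longrightarrow> A \<subseteq> B \<Longrightarrow> B \<subseteq> X \<Longrightarrow> B \<in> p"
  unfolding filter_on_def by blast

lemma filter_on_Int_iff:
  assumes "filter_on X p" "A \<subseteq> X" "B \<subseteq> X"
  shows "A \<inter> B \<in> p \<longleftrightarrow> A \<in> p \<and> B \<in> p"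
  using assms unfolding filter_on_def by (meson Int_lower1 Int_lower2)

lemma filter_on_nonempty: "filter_on X p \<Longrightarrow> A \<in> p \<Longrightarrow> A \<noteq> {}"
  unfolding filter_on_def by blast

lemma filter_on_subset: "filter_on X p \<Longrightarrow> A \<in> p \<Longrightarrow> A \<subseteq> X"
  unfolding filter_on_def by blast

lemma filter_on_empty: "filter_on X p \<Longrightarrow> {} \<notin> p"
  unfolding filter_on_def by blast

lemma filter_on_Int: "filter_on X p \<Longrightarrow> A \<in> p \<Longrightarrow> B \<in> p \<Longrightarrow> A \<inter> B \<in> p"
  unfolding filter_on_def by blast

lemma filter_on_space: "filter_on X p \<Longrightarrow> X \<in> p"
  unfolding filter_on_def by blast

lemma ultrafilter_on_imp_filter_on: "ultrafilter_on X p \<Longrightarrow> filter_on X p"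
  unfolding ultrafilter_on_def by blast

lemma ultrafilter_on_Diff_iff:
  assumes "ultrafilter_on X p" "A \<subseteq> X"
  shows "X - A \<in> p \<longleftrightarrow> A \<notin> p"
proof -
  have "filter_on X p" using assms by (simp add: ultrafilter_on_def)
  moreover have "A \<inter> (X - A) = {}" by blast
  ultimately have "\<not> (A \<in> p \<and> X - A \<in> p)"
    unfolding filter_on_def by metis
  with assms show ?thesis unfolding ultrafilter_on_def by blast
qed

lemma ultrafilter_on_maximal:
  assumes "ultrafilter_on X p" "filter_on X q" "p \<subseteq> q"
  shows "p = q"
proof
  show "q \<subseteq> p"
  proof
    fix A assume A: "A \<in> q"
    with assms have "A \<subseteq> X" by (blast dest: filter_on_subset)
    moreover have "A \<inter> (X - A) = {}" by blast
    ultimately have "X - A \<notin> p"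
      using A assms(2,3) unfolding filter_on_def by (metis subsetD)
    with assms \<open>A \<subseteq> X\<close> show "A \<in> p" unfolding ultrafilter_on_def by blast
  qed
qed fact

lemma filter_extends_to_ultrafilter:
  assumes F: "filter_on X F"
  obtains u where "ultrafilter_on X u" "F \<subseteq> u"
proof -
  define \<A> where "\<A> = {E. filter_on X E \<and> F \<subseteq> E}"
  have "\<exists>u\<in>\<A>. \<forall>E\<in>\<A>. u \<subseteq> E \<longrightarrow> E = u"
  proof (rule subset_Zorn_nonempty)
    show "\<A> \<noteq> {}" using F by (auto simp: \<A>_def)
    fix \<C> assume ne: "\<C> \<noteq> {}" and ch: "subset.chain \<A> \<C>"
    then have C: "filter_on X E \<and> F \<subseteq> E" if "E \<in> \<C>" for E
      using that unfolding subset_chain_def \<A>_def by blast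
    have "filter_on X (\<Union>\<C>)"
    proof (rule filter_onI)
      show "\<Union>\<C> \<subseteq> Pow X" "{} \<notin> \<Union>\<C>" "X \<in> \<Union>\<C>"
        using C ne filter_on_subset filter_on_empty filter_on_space by blast+
    next
      fix A B assume "A \<in> \<Union>\<C>" "B \<in> \<Union>\<C>"
      then obtain E\<^sub>1 E\<^sub>2 where E: "E\<^sub>1 \<in> \<C>" "A \<in> E\<^sub>1" "E\<^sub>2 \<in> \<C>" "B \<in> E\<^sub>2"
        by blast
      then have "E\<^sub>1 \<subseteq> E\<^sub>2 \<or> E\<^sub>2 \<subseteq> E\<^sub>1"
        using ch by (simp add: subset_chain_def)
      with E obtain E where "E \<in> \<C>" "A \<in> E" "B \<in> E" by blast
      then show "A \<inter> B \<in> \<Union>\<C>" using C filter_on_Int by blast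
    next
      fix A B assume "A \<in> \<Union>\<C>" "A \<subseteq> B" "B \<subseteq> X"
      then show "B \<in> \<Union>\<C>" using C filter_on_mono by blast
    qed
    moreover have "F \<subseteq> \<Union>\<C>" using C ne by blast
    ultimately show "\<Union>\<C> \<in> \<A>" by (simp add: \<A>_def)
  qed
  then obtain u where "u \<in> \<A>" and max: "\<forall>E\<in>\<A>. u \<subseteq> E \<longrightarrow> E = u" ..
  then have u: "filter_on X u" "F \<subseteq> u" by (simp_all add: \<A>_def)
  have "A \<in> u" if A: "A \<subseteq> X" and nA: "X - A \<notin> u" for A
  proof -
    \<comment> \<open>The filter generated by \<open>u\<close> and \<open>A\<close> is proper because \<open>X - A \<notin> u\<close>.\<close>
    define E where "E = {B. B \<subseteq> X \<and> (\<exists>C\<in>u. C \<inter> A \<subseteq> B)}"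
    have AE: "A \<in> E" and uE: "u \<subseteq> E"
      using filter_on_space[OF u(1)] filter_on_subset[OF u(1)] A by (auto simp: E_def)
    have "filter_on X E"
    proof (rule filter_onI)
      show "E \<subseteq> Pow X" by (auto simp: E_def)
      show "X \<in> E" using uE filter_on_space[OF u(1)] by blast
      show "{} \<notin> E"
      proof
        assume "{} \<in> E"
        then obtain C where "C \<in> u" "C \<inter> A \<subseteq> {}" by (auto simp: E_def)
        then have "X - A \<in> u"
          using filter_on_mono[OF u(1), of C "X - A"] filter_on_subset[OF u(1), of C] by blast
        with nA show False ..
      qed
    next
      fix B B' assume BB: "B \<in> E" "B' \<in> E"
      then obtain C C' where C: "C \<in> u" "C' \<in> u" "C \<inter> A \<subseteq> B" "C' \<inter> A \<subseteq> B'"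
        by (auto simp: E_def)
      have "C \<inter> C' \<in> u" using filter_on_Int[OF u(1)] C by blast
      moreover have "(C \<inter> C') \<inter> A \<subseteq> B \<inter> B'" using C by blast
      ultimately show "B \<inter> B' \<in> E" using BB unfolding E_def by blast
    next
      fix B B' assume "B \<in> E" "B \<subseteq> B'" "B' \<subseteq> X"
      then show "B' \<in> E" unfolding E_def by blast
    qed
    with u(2) uE have "E \<in> \<A>" by (simp add: \<A>_def)
    with max uE AE show ?thesis by blast
  qed
  with u have "ultrafilter_on X u" unfolding ultrafilter_on_def by blast
  with u(2) that show ?thesis by blast
qed

section \<open>The topology of the space of ultrafilters\<close>

lemma openin_sc_topology_iff:
  "openin (sc_topology X) U \<longleftrightarrow> (\<forall>u\<in>U. \<exists>A\<subseteq>X. u \<in> sc_cl X A \<and> sc_cl X A \<subseteq> U)"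
  unfolding openin_sc_topology arbitrary_union_of_alt by (intro ball_cong refl) auto

lemma openin_sc_cl: "A \<subseteq> X \<Longrightarrow> openin (sc_topology X) (sc_cl X A)"
  unfolding openin_sc_topology_iff by (auto intro!: exI[of _ A])

lemma sc_cl_Diff: "A \<subseteq> X \<Longrightarrow> sc_cl X (X - A) = stone_cech X - sc_cl X A"
  using ultrafilter_on_Diff_iff by (auto simp: sc_cl_def stone_cech_def)

lemma closedin_sc_cl: "A \<subseteq> X \<Longrightarrow> closedin (sc_topology X) (sc_cl X A)"
  using openin_sc_cl[of "X - A" X]
  by (auto simp: closedin_def topspace_sc_topology sc_cl_Diff) (simp add: sc_cl_def)

lemma Hausdorff_sc_topology: "Hausdorff_space (sc_topology X)"
  unfolding Hausdorff_space_def topspace_sc_topology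
proof (intro allI impI)
  fix p q assume "p \<in> stone_cech X \<and> q \<in> stone_cech X \<and> p \<noteq> q"
  then have p: "p \<in> stone_cech X" and q: "q \<in> stone_cech X" and "p \<noteq> q" by auto
  then have "\<not> p \<subseteq> q"
    using ultrafilter_on_maximal by (auto simp: stone_cech_def ultrafilter_on_def)
  then obtain A where A: "A \<in> p" "A \<notin> q" by blast
  then have "A \<subseteq> X"
    using p filter_on_subset by (auto simp: stone_cech_def ultrafilter_on_def)
  then have "p \<in> sc_cl X A" "q \<in> sc_cl X (X - A)" "disjnt (sc_cl X A) (sc_cl X (X - A))"
    using A p q by (auto simp: sc_cl_Diff disjnt_def) (auto simp: sc_cl_def)
  then show "\<exists>U V. openin (sc_topology X) U \<and> openin (sc_topology X) V
      \<and> p \<in> U \<and> q \<in> V \<and> disjnt U V"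
    using openin_sc_cl \<open>A \<subseteq> X\<close> Diff_subset by metis
qed

text \<open>
  If an open cover \<open>\<U>\<close> has no finite subcover, the sets \<open>B\<close> such that finitely many members of
  \<open>\<U>\<close> cover all ultrafilters avoiding \<open>B\<close> form a proper filter; an ultrafilter that extends it
  lies in no member of \<open>\<U>\<close>.
\<close>

lemma compact_sc_topology: "compact_space (sc_topology X)"
  unfolding compact_space_alt topspace_sc_topology
proof (intro allI impI)
  fix \<U> assume "(\<forall>U\<in>\<U>. openin (sc_topology X) U) \<and> stone_cech X \<subseteq> \<Union>\<U>"
  then have op: "\<And>U. U \<in> \<U> \<Longrightarrow> openin (sc_topology X) U" and cov: "stone_cech X \<subseteq> \<Union>\<U>"
    by auto
  show "\<exists>\<F>. finite \<F> \<and> \<F> \<subseteq> \<U> \<and> stone_cech X \<subseteq> \<Union>\<F>"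
  proof (rule ccontr)
    assume no: "\<not> ?thesis"
    define F where "F = {B. B \<subseteq> X \<and> (\<exists>\<F>. finite \<F> \<and> \<F> \<subseteq> \<U> \<and> stone_cech X - sc_cl X B \<subseteq> \<Union>\<F>)}"
    have "sc_cl X X = stone_cech X" "sc_cl X {} = {}"
      using filter_on_space filter_on_empty
      by (auto simp: sc_cl_def stone_cech_def ultrafilter_on_def)
    then have F: "X \<in> F" "{} \<notin> F" "F \<subseteq> Pow X"
      using no by (auto simp: F_def)
    have inter: "A \<inter> B \<in> F" if AB: "A \<in> F" "B \<in> F" for A B
    proof -
      obtain \<F> \<G> where "finite \<F>" "\<F> \<subseteq> \<U>" "stone_cech X - sc_cl X A \<subseteq> \<Union>\<F>"
        "finite \<G>" "\<G> \<subseteq> \<U>" "stone_cech X - sc_cl X B \<subseteq> \<Union>\<G>"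
        using AB by (auto simp: F_def)
      moreover have "sc_cl X A \<inter> sc_cl X B = sc_cl X (A \<inter> B)"
        using AB by (intro sc_cl_Int) (auto simp: F_def)
      ultimately have "finite (\<F> \<union> \<G>)" "\<F> \<union> \<G> \<subseteq> \<U>"
        "stone_cech X - sc_cl X (A \<inter> B) \<subseteq> \<Union>(\<F> \<union> \<G>)" by auto
      moreover have "A \<inter> B \<subseteq> X" using AB by (auto simp: F_def)
      ultimately show ?thesis unfolding F_def by blast
    qed
    have mono: "B \<in> F" if "A \<in> F" "A \<subseteq> B" "B \<subseteq> X" for A B
    proof -
      have "sc_cl X A \<subseteq> sc_cl X B"
        using that filter_on_mono
        unfolding sc_cl_def stone_cech_def ultrafilter_on_def by blast
      moreover from that obtain \<F> where "finite \<F>" "\<F> \<subseteq> \<U>" "stone_cech X - sc_cl X A \<subseteq> \<Union>\<F>"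
        by (auto simp: F_def)
      ultimately have "finite \<F> \<and> \<F> \<subseteq> \<U> \<and> stone_cech X - sc_cl X B \<subseteq> \<Union>\<F>" by blast
      with that show ?thesis unfolding F_def by blast
    qed
    have "filter_on X F" by (rule filter_onI) (fact F inter mono)+
    then obtain u where u: "ultrafilter_on X u" "F \<subseteq> u"
      by (rule filter_extends_to_ultrafilter)
    then obtain U where U: "U \<in> \<U>" "u \<in> U" using cov by (auto simp: stone_cech_def)
    then obtain A where A: "A \<subseteq> X" "u \<in> sc_cl X A" "sc_cl X A \<subseteq> U"
      using op unfolding openin_sc_topology_iff by blast
    then have "stone_cech X - sc_cl X (X - A) \<subseteq> \<Union>{U}"
      by (auto simp: sc_cl_Diff)
    with U(1) have "X - A \<in> F" unfolding F_def by blast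
    with u A show False by (auto simp: sc_cl_def ultrafilter_on_Diff_iff)
  qed
qed

section \<open>Idempotents in compact right topological semigroups\<close>

text \<open>
  Zorn's lemma for closed sets ordered by reverse inclusion: compactness keeps the intersection of
  a chain nonempty. The argument runs on complements, which are open and grow.
\<close>

lemma compact_space_minimal_closed:
  assumes X: "compact_space X" "topspace X \<noteq> {}" and P: "P (topspace X)"
    and inter: "\<And>\<C>. \<C> \<noteq> {} \<Longrightarrow> (\<And>S. S \<in> \<C> \<Longrightarrow> closedin X S \<and> P S) \<Longrightarrow> P (\<Inter>\<C>)"
  obtains S where "closedin X S" "S \<noteq> {}" "P S"
    "\<And>T. closedin X T \<Longrightarrow> T \<noteq> {} \<Longrightarrow> P T \<Longrightarrow> T \<subseteq> S \<Longrightarrow> T = S"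
proof -
  define \<A> where "\<A> = {U. openin X U \<and> U \<noteq> topspace X \<and> P (topspace X - U)}"
  have "\<exists>M\<in>\<A>. \<forall>U\<in>\<A>. M \<subseteq> U \<longrightarrow> U = M"
  proof (rule subset_Zorn_nonempty)
    have "{} \<in> \<A>" using X(2)[symmetric] P by (simp add: \<A>_def)
    then show "\<A> \<noteq> {}" by blast
    fix \<C> assume ne: "\<C> \<noteq> {}" and ch: "subset.chain \<A> \<C>"
    then have C: "U \<in> \<A>" if "U \<in> \<C>" for U
      using that unfolding subset_chain_def by blast
    have "\<Union>\<C> \<noteq> topspace X"
    proof
      assume eq: "\<Union>\<C> = topspace X"
      moreover have "\<forall>U\<in>\<C>. openin X U" using C by (simp add: \<A>_def)
      ultimately obtain \<F> where \<F>: "finite \<F>" "\<F> \<subseteq> \<C>" "\<Union>\<F> = topspace X"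
        using X(1)[unfolded compact_space, rule_format, of \<C>] by auto
      moreover have "\<F> \<noteq> {}" using \<F>(3) X(2) by (metis Union_empty)
      moreover have "subset.chain \<A> \<F>"
        using ch \<F>(2) unfolding subset_chain_def by blast
      ultimately have "topspace X \<in> \<C>" using Union_in_chain by (metis subsetD)
      with C show False by (auto simp: \<A>_def)
    qed
    moreover have "P (\<Inter>U\<in>\<C>. topspace X - U)"
      using ne C by (intro inter) (auto simp: \<A>_def)
    moreover have "(\<Inter>U\<in>\<C>. topspace X - U) = topspace X - \<Union>\<C>" using ne by blast
    ultimately show "\<Union>\<C> \<in> \<A>" using C by (auto simp: \<A>_def)
  qed
  then obtain M where M: "M \<in> \<A>" and max: "\<And>U. U \<in> \<A> \<Longrightarrow> M \<subseteq> U \<Longrightarrow> U = M" by blast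
  show ?thesis
  proof (rule that[of "topspace X - M"])
    show "closedin X (topspace X - M)" "P (topspace X - M)"
      using M by (auto simp: \<A>_def)
    show "topspace X - M \<noteq> {}"
      using M openin_subset by (fastforce simp: \<A>_def)
    fix T assume T: "closedin X T" "T \<noteq> {}" "P T" "T \<subseteq> topspace X - M"
    then have "T \<subseteq> topspace X" by (simp add: closedin_subset)
    then have "topspace X - (topspace X - T) = T" by blast
    then have "topspace X - T \<in> \<A>" using T by (auto simp: \<A>_def)
    moreover have "M \<subseteq> topspace X - T" using T M openin_subset by (fastforce simp: \<A>_def)
    ultimately show "T = topspace X - M"
      using max \<open>topspace X - (topspace X - T) = T\<close> by metis
  qed
qed

text \<open>
  The Ellis--Numakura lemma. If \<open>s\<close> is in a minimal closed subsemigroup \<open>S\<close>, then \<open>Ss\<close> is again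
  a closed subsemigroup, so \<open>Ss = S\<close>; hence \<open>{t \<in> S. ts = s}\<close> is nonempty, and it is a closed
  subsemigroup too, so it contains \<open>s\<close>.
\<close>

lemma compact_right_topological_semigroup_idempotent:
  fixes m :: "'s \<Rightarrow> 's \<Rightarrow> 's" (infixl "\<star>" 70)
  assumes X: "compact_space X" "Hausdorff_space X" "topspace X \<noteq> {}"
    and closed: "\<And>x y. x \<in> topspace X \<Longrightarrow> y \<in> topspace X \<Longrightarrow> x \<star> y \<in> topspace X"
    and assoc: "\<And>x y z. x \<in> topspace X \<Longrightarrow> y \<in> topspace X \<Longrightarrow> z \<in> topspace X
      \<Longrightarrow> (x \<star> y) \<star> z = x \<star> (y \<star> z)"
    and cont: "\<And>y. y \<in> topspace X \<Longrightarrow> continuous_map X X (\<lambda>x. x \<star> y)"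
  obtains e where "e \<in> topspace X" "e \<star> e = e"
proof -
  obtain S where S: "closedin X S" "S \<noteq> {}" and mult: "\<forall>x\<in>S. \<forall>y\<in>S. x \<star> y \<in> S"
    and min: "\<And>T. closedin X T \<Longrightarrow> T \<noteq> {} \<Longrightarrow> \<forall>x\<in>T. \<forall>y\<in>T. x \<star> y \<in> T \<Longrightarrow> T \<subseteq> S \<Longrightarrow> T = S"
    by (rule compact_space_minimal_closed[OF X(1,3), of "\<lambda>S. \<forall>x\<in>S. \<forall>y\<in>S. x \<star> y \<in> S"])
      (auto simp: closed)
  have sub: "x \<in> topspace X" if "x \<in> S" for x
    using that S(1) closedin_subset by blast
  obtain s where s: "s \<in> S" using S(2) by blast
  have "(\<lambda>x. x \<star> s) ` S = S"
  proof (rule min)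
    show "closedin X ((\<lambda>x. x \<star> s) ` S)"
      using X(2) image_compactin[OF closedin_compact_space[OF X(1) S(1)] cont[OF sub[OF s]]]
      by (rule compactin_imp_closedin)
    show "\<forall>x\<in>(\<lambda>x. x \<star> s) ` S. \<forall>y\<in>(\<lambda>x. x \<star> s) ` S. x \<star> y \<in> (\<lambda>x. x \<star> s) ` S"
    proof clarify
      fix x y assume xy: "x \<in> S" "y \<in> S"
      then have "(x \<star> s) \<star> (y \<star> s) = (x \<star> s \<star> y) \<star> s"
        using s mult sub by (simp add: assoc)
      then show "(x \<star> s) \<star> (y \<star> s) \<in> (\<lambda>x. x \<star> s) ` S"
        using xy s mult by auto
    qed
    show "(\<lambda>x. x \<star> s) ` S \<noteq> {}" "(\<lambda>x. x \<star> s) ` S \<subseteq> S" using s mult by blast+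
  qed
  then obtain t where t: "t \<in> S" "t \<star> s = s" using s by (metis imageE)
  let ?T = "{x \<in> S. x \<star> s = s}"
  have "?T = S"
  proof (rule min)
    have "closedin X {x \<in> topspace X. x \<star> s \<in> {s}}"
      using cont[OF sub[OF s]] closedin_Hausdorff_singleton[OF X(2) sub[OF s]]
      by (rule closedin_continuous_map_preimage)
    then have "closedin X (S \<inter> {x \<in> topspace X. x \<star> s \<in> {s}})"
      using S(1) by blast
    moreover have "S \<inter> {x \<in> topspace X. x \<star> s \<in> {s}} = ?T" using sub by auto
    ultimately show "closedin X ?T" by simp
    show "\<forall>x\<in>?T. \<forall>y\<in>?T. x \<star> y \<in> ?T"
      using mult s sub by (simp add: assoc)
    show "?T \<noteq> {}" "?T \<subseteq> S" using t by blast+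
  qed
  then have "s \<star> s = s" using s by blast
  with s sub that show ?thesis by blast
qed

section \<open>The action of ultrafilters on ultrafilters\<close>

text \<open>
  For an action by bijections this is \<open>{g \<in> S. A \<in> gp}\<close>; written with preimages it makes sense
  for arbitrary maps, which are what the multiplication of a monoid provides.
\<close>

definition visits :: "'a set \<Rightarrow> 'b set \<Rightarrow> ('a \<Rightarrow> 'b \<Rightarrow> 'b) \<Rightarrow> 'b set set \<Rightarrow> 'b set \<Rightarrow> 'a set" where
  "visits S X \<phi> p A = {g \<in> S. \<phi> g -` A \<inter> X \<in> p}"

lemma visits_subset: "visits S X \<phi> p A \<subseteq> S"
  by (auto simp: visits_def)

text \<open>This turns the base that defines \<open>qp\<close> into an iterated limit: \<open>A \<in> qp\<close> iff
  \<open>gx \<in> A\<close> for \<open>q\<close>-almost all \<open>g\<close> and \<open>p\<close>-almost all \<open>x\<close>.\<close>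

lemma mem_uf_act_iff:
  assumes q: "filter_on S q" and p: "filter_on X p"
  shows "A \<in> uf_act X \<phi> q p \<longleftrightarrow> A \<subseteq> X \<and> visits S X \<phi> p A \<in> q"
proof
  assume "A \<in> uf_act X \<phi> q p"
  then obtain Q P where A: "A \<subseteq> X" and Q: "Q \<in> q" and P: "\<forall>g\<in>Q. P g \<in> p"
    and sub: "(\<Union>g\<in>Q. \<phi> g ` P g) \<subseteq> A"
    unfolding uf_act_def by blast
  have "Q \<subseteq> visits S X \<phi> p A"
  proof
    fix g assume g: "g \<in> Q"
    then have "P g \<subseteq> \<phi> g -` A \<inter> X"
      using P sub filter_on_subset[OF p] by blast
    then have "\<phi> g -` A \<inter> X \<in> p"
      using filter_on_mono[OF p] P g by blast
    then show "g \<in> visits S X \<phi> p A"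
      using g Q filter_on_subset[OF q] by (auto simp: visits_def)
  qed
  then show "A \<subseteq> X \<and> visits S X \<phi> p A \<in> q"
    using A filter_on_mono[OF q Q _ visits_subset] by blast
next
  assume A: "A \<subseteq> X \<and> visits S X \<phi> p A \<in> q"
  let ?P = "\<lambda>g. \<phi> g -` A \<inter> X"
  have "(\<forall>g\<in>visits S X \<phi> p A. ?P g \<in> p) \<and> (\<Union>g\<in>visits S X \<phi> p A. \<phi> g ` ?P g) \<subseteq> A"
    by (auto simp: visits_def)
  then have "\<exists>P. (\<forall>g\<in>visits S X \<phi> p A. P g \<in> p) \<and> (\<Union>g\<in>visits S X \<phi> p A. \<phi> g ` P g) \<subseteq> A"
    by (rule exI[of _ ?P])
  with A show "A \<in> uf_act X \<phi> q p" by (simp add: uf_act_def bexI)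
qed

lemma visits_Int:
  assumes "filter_on X p"
  shows "visits S X \<phi> p (A \<inter> B) = visits S X \<phi> p A \<inter> visits S X \<phi> p B"
proof -
  have "\<phi> g -` (A \<inter> B) \<inter> X = (\<phi> g -` A \<inter> X) \<inter> (\<phi> g -` B \<inter> X)" for g by blast
  then show ?thesis
    using assms by (auto simp: visits_def filter_on_Int_iff)
qed

lemma visits_mono:
  assumes "filter_on X p" "A \<subseteq> B"
  shows "visits S X \<phi> p A \<subseteq> visits S X \<phi> p B"
  using visits_Int[OF assms(1), of S \<phi> A B] by (simp add: inf.absorb1[OF assms(2)] inf.absorb_iff1)

lemma visits_space:
  assumes "filter_on X p" "\<And>g x. g \<in> S \<Longrightarrow> x \<in> X \<Longrightarrow> \<phi> g x \<in> X"
  shows "visits S X \<phi> p X = S"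
proof -
  have "\<phi> g -` X \<inter> X = X" if "g \<in> S" for g using assms(2) that by blast
  then show ?thesis using filter_on_space[OF assms(1)] by (auto simp: visits_def)
qed

lemma visits_Diff:
  assumes p: "ultrafilter_on X p" and maps: "\<And>g x. g \<in> S \<Longrightarrow> x \<in> X \<Longrightarrow> \<phi> g x \<in> X"
  shows "visits S X \<phi> p (X - A) = S - visits S X \<phi> p A"
proof -
  have "\<phi> g -` (X - A) \<inter> X = X - (\<phi> g -` A \<inter> X)" if "g \<in> S" for g
    using maps that by blast
  then show ?thesis
    using ultrafilter_on_Diff_iff[OF p] by (auto simp: visits_def)
qed

lemma ultrafilter_on_uf_act:
  assumes q: "ultrafilter_on S q" and p: "ultrafilter_on X p"
    and maps: "\<And>g x. g \<in> S \<Longrightarrow> x \<in> X \<Longrightarrow> \<phi> g x \<in> X"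
  shows "ultrafilter_on X (uf_act X \<phi> q p)"
proof -
  have fq: "filter_on S q" and fp: "filter_on X p"
    using q p by (simp_all add: ultrafilter_on_def)
  note mem = mem_uf_act_iff[OF fq fp]
  have "visits S X \<phi> p {} = {}"
    using filter_on_empty[OF fp] by (auto simp: visits_def)
  then have empty: "{} \<notin> uf_act X \<phi> q p"
    using filter_on_empty[OF fq] by (simp add: mem)
  have space: "X \<in> uf_act X \<phi> q p"
    using filter_on_space[OF fq] visits_space[of X p S \<phi>, OF fp maps] by (simp add: mem)
  have "filter_on X (uf_act X \<phi> q p)"
  proof (rule filter_onI)
    show "uf_act X \<phi> q p \<subseteq> Pow X" by (auto simp: uf_act_def)
  next
    fix A B assume "A \<in> uf_act X \<phi> q p" "B \<in> uf_act X \<phi> q p"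
    then show "A \<inter> B \<in> uf_act X \<phi> q p"
      by (auto simp: mem visits_Int[OF fp] filter_on_Int[OF fq])
  next
    fix A B assume "A \<in> uf_act X \<phi> q p" "A \<subseteq> B" "B \<subseteq> X"
    then show "B \<in> uf_act X \<phi> q p"
      using filter_on_mono[OF fq _ visits_mono[OF fp, of A B] visits_subset, of \<phi>]
      by (simp add: mem)
  qed (use empty space in auto)
  moreover have "A \<in> uf_act X \<phi> q p \<or> X - A \<in> uf_act X \<phi> q p" if "A \<subseteq> X" for A
    using that visits_Diff[of X p S \<phi> A, OF p maps]
      ultrafilter_on_Diff_iff[OF q visits_subset[of S X \<phi> p A]]
    by (auto simp: mem)
  ultimately show ?thesis by (simp add: ultrafilter_on_def)
qed

lemma continuous_map_uf_act:
  assumes p: "ultrafilter_on X p" and maps: "\<And>g x. g \<in> S \<Longrightarrow> x \<in> X \<Longrightarrow> \<phi> g x \<in> X"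
  shows "continuous_map (sc_topology S) (sc_topology X) (\<lambda>q. uf_act X \<phi> q p)"
proof -
  have fp: "filter_on X p" using p by (simp add: ultrafilter_on_def)
  have uf: "uf_act X \<phi> q p \<in> stone_cech X" if "q \<in> stone_cech S" for q
    using that ultrafilter_on_uf_act[of S q X p \<phi>, OF _ p maps] by (simp add: stone_cech_def)
  have basic: "uf_act X \<phi> q p \<in> sc_cl X A \<longleftrightarrow> q \<in> sc_cl S (visits S X \<phi> p A)"
    if "q \<in> stone_cech S" "A \<subseteq> X" for q A
    using that uf[OF that(1)] mem_uf_act_iff[OF _ fp, of S q A \<phi>]
    by (auto simp: sc_cl_def stone_cech_def ultrafilter_on_def)
  show ?thesis
    unfolding continuous_map topspace_sc_topology
  proof (intro conjI allI impI)
    fix U assume U: "openin (sc_topology X) U"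
    show "openin (sc_topology S) {q \<in> stone_cech S. uf_act X \<phi> q p \<in> U}"
      unfolding openin_sc_topology_iff
    proof clarify
      fix q assume q: "q \<in> stone_cech S" "uf_act X \<phi> q p \<in> U"
      then obtain A where A: "A \<subseteq> X" "uf_act X \<phi> q p \<in> sc_cl X A" "sc_cl X A \<subseteq> U"
        using U unfolding openin_sc_topology_iff by blast
      have "sc_cl S (visits S X \<phi> p A) \<subseteq> {q \<in> stone_cech S. uf_act X \<phi> q p \<in> U}"
        using A basic by (auto simp: sc_cl_def)
      moreover have "q \<in> sc_cl S (visits S X \<phi> p A)"
        using A q basic by blast
      ultimately show "\<exists>B\<subseteq>S. q \<in> sc_cl S B \<and> sc_cl S B \<subseteq> {q \<in> stone_cech S. uf_act X \<phi> q p \<in> U}"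
        using visits_subset by (intro exI[of _ "visits S X \<phi> p A"] conjI)
    qed
  qed (use uf in blast)
qed

text \<open>
  Both sides say that \<open>ghx \<in> A\<close> for \<open>q\<close>-almost all \<open>g\<close>, \<open>r\<close>-almost all \<open>h\<close> and \<open>p\<close>-almost
  all \<open>x\<close>. With \<open>X = G\<close> this is associativity of the multiplication of \<open>\<beta>G\<close>.
\<close>

lemma uf_act_uf_mult:
  fixes G (structure)
  assumes q: "ultrafilter_on (carrier G) q" and r: "ultrafilter_on (carrier G) r"
    and p: "ultrafilter_on X p"
    and G: "\<And>g h. g \<in> carrier G \<Longrightarrow> h \<in> carrier G \<Longrightarrow> g \<otimes> h \<in> carrier G"
    and maps: "\<And>g x. g \<in> carrier G \<Longrightarrow> x \<in> X \<Longrightarrow> \<phi> g x \<in> X"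
    and comp: "\<And>g h x. g \<in> carrier G \<Longrightarrow> h \<in> carrier G \<Longrightarrow> x \<in> X \<Longrightarrow> \<phi> (g \<otimes> h) x = \<phi> g (\<phi> h x)"
  shows "uf_act X \<phi> (uf_mult G q r) p = uf_act X \<phi> q (uf_act X \<phi> r p)"
proof -
  have f: "filter_on (carrier G) q" "filter_on (carrier G) r" "filter_on X p"
    using q r p by (simp_all add: ultrafilter_on_def)
  have m: "filter_on (carrier G) (uf_mult G q r)" and a: "filter_on X (uf_act X \<phi> r p)"
    using ultrafilter_on_uf_act[OF q r] ultrafilter_on_uf_act[OF r p] G maps
    by (auto simp: uf_mult_def ultrafilter_on_def)
  have "visits (carrier G) (carrier G) (mult G) r (visits (carrier G) X \<phi> p A)
      = visits (carrier G) X \<phi> (uf_act X \<phi> r p) A" for A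
  proof -
    have "\<phi> (g \<otimes> h) -` A \<inter> X = \<phi> h -` (\<phi> g -` A \<inter> X) \<inter> X"
      if "g \<in> carrier G" "h \<in> carrier G" for g h
      using that comp maps by auto
    then have "mult G g -` visits (carrier G) X \<phi> p A \<inter> carrier G
        = visits (carrier G) X \<phi> p (\<phi> g -` A \<inter> X)" if "g \<in> carrier G" for g
      using that G by (auto simp: visits_def)
    then show ?thesis
      unfolding visits_def[of _ _ _ r] visits_def[of _ _ _ "uf_act X \<phi> r p"]
      by (auto simp: mem_uf_act_iff[OF f(2,3)])
  qed
  then have "A \<in> uf_act X \<phi> (uf_mult G q r) p \<longleftrightarrow> A \<in> uf_act X \<phi> q (uf_act X \<phi> r p)" for A
    using mem_uf_act_iff[OF f(1,2), of "visits (carrier G) X \<phi> p A" "mult G"]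
    by (simp add: mem_uf_act_iff[OF m f(3)] mem_uf_act_iff[OF f(1) a] visits_subset
        flip: uf_mult_def)
  then show ?thesis by blast
qed

section \<open>Ultrafilters on a group that fix a given ultrafilter\<close>

context group_action
begin

lemma maps_into: "g \<in> carrier G \<Longrightarrow> x \<in> E \<Longrightarrow> \<phi> g x \<in> E"
  by (rule element_image[OF _ _ refl])

lemma mem_uf_translate_iff:
  assumes g: "g \<in> carrier G" and p: "filter_on E p"
  shows "A \<in> uf_translate \<phi> g p \<longleftrightarrow> A \<subseteq> E \<and> \<phi> g -` A \<inter> E \<in> p"
proof
  assume "A \<in> uf_translate \<phi> g p"
  then obtain P where P: "P \<in> p" "A = \<phi> g ` P" by (auto simp: uf_translate_def)
  then have "P \<subseteq> E" using filter_on_subset[OF p] by blast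
  then show "A \<subseteq> E \<and> \<phi> g -` A \<inter> E \<in> p"
    using P maps_into[OF g] filter_on_mono[OF p, of P "\<phi> g -` A \<inter> E"] by auto
next
  assume A: "A \<subseteq> E \<and> \<phi> g -` A \<inter> E \<in> p"
  have "A \<subseteq> \<phi> g ` E" using A by (simp add: surj_prop[OF g])
  then have "A = \<phi> g ` (\<phi> g -` A \<inter> E)" by blast
  then show "A \<in> uf_translate \<phi> g p" using A by (auto simp: uf_translate_def)
qed

lemma mem_visits_iff:
  assumes "filter_on E p" "A \<subseteq> E"
  shows "g \<in> visits (carrier G) E \<phi> p A \<longleftrightarrow> g \<in> carrier G \<and> A \<in> uf_translate \<phi> g p"
  using assms by (auto simp: visits_def mem_uf_translate_iff)

lemma ultrafilter_on_uf_translate: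
  assumes g: "g \<in> carrier G" and p: "ultrafilter_on E p"
  shows "ultrafilter_on E (uf_translate \<phi> g p)"
proof -
  have fp: "filter_on E p" using p by (simp add: ultrafilter_on_def)
  \<comment> \<open>\<open>gp\<close> is the product of the unique ultrafilter on the one-point set \<open>{g}\<close> with \<open>p\<close>.\<close>
  have "ultrafilter_on {g} {{g}}"
    unfolding ultrafilter_on_def filter_on_def by (auto simp: subset_singleton_iff)
  then have "ultrafilter_on E (uf_act E \<phi> {{g}} p)"
    using p by (rule ultrafilter_on_uf_act) (use g maps_into in auto)
  moreover have f: "filter_on {g} {{g}}" using \<open>ultrafilter_on {g} {{g}}\<close>
    by (rule ultrafilter_on_imp_filter_on)
  moreover have "uf_act E \<phi> {{g}} p = uf_translate \<phi> g p"
    by (auto simp: mem_uf_act_iff[OF f fp] mem_uf_translate_iff[OF g fp] visits_def)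
  ultimately show ?thesis by simp
qed

lemma uf_translate_mult:
  assumes "g \<in> carrier G" "h \<in> carrier G" and p: "filter_on E p"
  shows "uf_translate \<phi> (g \<otimes> h) p = uf_translate \<phi> g (uf_translate \<phi> h p)"
proof -
  have "\<phi> (g \<otimes> h) ` P = \<phi> g ` (\<phi> h ` P)" if "P \<in> p" for P
    using that filter_on_subset[OF p] assms composition_rule
    by (force simp: image_image intro!: image_cong)
  then show ?thesis unfolding uf_translate_def by blast
qed

lemma uf_translate_one:
  assumes p: "filter_on E p"
  shows "uf_translate \<phi> \<one> p = p"
proof -
  have "\<phi> \<one> ` P = P" if "P \<in> p" for P
    using filter_on_subset[OF p that] by (auto simp flip: id_eq_one)
  then have "(`) (\<phi> \<one>) ` p = p" by simp
  moreover have "uf_translate \<phi> \<one> p = (`) (\<phi> \<one>) ` p" by (auto simp: uf_translate_def)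
  ultimately show ?thesis by simp
qed

text \<open>Almost constant functions have the expected limit along \<open>q\<close>.\<close>

lemma uf_act_eq_translate:
  assumes q: "filter_on (carrier G) q" and p: "filter_on E p"
    and s: "ultrafilter_on E s" and act: "ultrafilter_on E (uf_act E \<phi> q p)"
    and const: "{h \<in> carrier G. uf_translate \<phi> h p = s} \<in> q"
  shows "uf_act E \<phi> q p = s"
proof -
  have "s \<subseteq> uf_act E \<phi> q p"
  proof
    fix A assume A: "A \<in> s"
    then have "A \<subseteq> E" using s filter_on_subset by (auto simp: ultrafilter_on_def)
    moreover from this have "visits (carrier G) E \<phi> p A \<in> q"
      using A by (intro filter_on_mono[OF q const] visits_subset) (auto simp: mem_visits_iff[OF p])
    ultimately show "A \<in> uf_act E \<phi> q p" by (simp add: mem_uf_act_iff[OF q p])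
  qed
  then show ?thesis
    using ultrafilter_on_maximal[OF s ultrafilter_on_imp_filter_on[OF act]] by simp
qed

text \<open>
  The nonempty fibres of \<open>h \<mapsto> hp\<close> are the left cosets of \<open>St(p)\<close>. On a fibre in \<open>q\<close> the constant
  value would be \<open>qp = p\<close>, so the fibre would be \<open>St(p)\<close>, whose complement is in \<open>q\<close>.
\<close>

lemma fixing_uf_avoids_fibres:
  assumes q: "ultrafilter_on (carrier G) q" and p: "ultrafilter_on E p"
    and off: "carrier G - stabilizer G (uf_translate \<phi>) p \<in> q"
    and fix_p: "uf_act E \<phi> q p = p" and s: "ultrafilter_on E s"
  shows "{h \<in> carrier G. uf_translate \<phi> h p = s} \<notin> q"
proof
  assume *: "{h \<in> carrier G. uf_translate \<phi> h p = s} \<in> q"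
  have "uf_act E \<phi> q p = s"
    using q p s * fix_p by (intro uf_act_eq_translate) (auto simp: ultrafilter_on_def)
  then have "stabilizer G (uf_translate \<phi>) p \<in> q"
    using * fix_p by (simp add: stabilizer_def)
  moreover have "stabilizer G (uf_translate \<phi>) p \<subseteq> carrier G" by (auto simp: stabilizer_def)
  ultimately show False using ultrafilter_on_Diff_iff[OF q] off by blast
qed

lemma fixing_uf_nonprincipal:
  assumes q: "ultrafilter_on (carrier G) q" and p: "ultrafilter_on E p"
    and off: "carrier G - stabilizer G (uf_translate \<phi>) p \<in> q"
    and fix_p: "uf_act E \<phi> q p = p"
  shows "q \<in> sc_star (carrier G) (carrier G - stabilizer G (uf_translate \<phi>) p)"
proof -
  have "q \<noteq> principal_uf (carrier G) g" if g: "g \<in> carrier G" for g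
    using fixing_uf_avoids_fibres[OF assms ultrafilter_on_uf_translate[OF g p]] g
    by (auto simp: principal_uf_def)
  then show ?thesis
    using q off by (auto simp: sc_star_def sc_remainder_def stone_cech_def)
qed

text \<open>
  Why the fixing ultrafilters that avoid \<open>St(p)\<close> form a subsemigroup: since \<open>r\<close> contains no left
  coset of \<open>St(p)\<close>, it contains \<open>g\<inverse>(G - St(p))\<close> for every \<open>g \<in> G\<close>, hence \<open>q\<close>-almost surely.
\<close>

lemma fixing_uf_mult:
  assumes q: "ultrafilter_on (carrier G) q" and r: "ultrafilter_on (carrier G) r"
    and p: "ultrafilter_on E p"
    and off: "carrier G - stabilizer G (uf_translate \<phi>) p \<in> r"
    and fix_p: "uf_act E \<phi> q p = p" "uf_act E \<phi> r p = p"
  shows "ultrafilter_on (carrier G) (uf_mult G q r)"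
    and "carrier G - stabilizer G (uf_translate \<phi>) p \<in> uf_mult G q r"
    and "uf_act E \<phi> (uf_mult G q r) p = p"
proof -
  interpret group G using group_hom group_hom.axioms(1) by auto
  have f: "filter_on (carrier G) q" "filter_on (carrier G) r" "filter_on E p"
    using q r p by (simp_all add: ultrafilter_on_def)
  show "ultrafilter_on (carrier G) (uf_mult G q r)"
    unfolding uf_mult_def by (rule ultrafilter_on_uf_act[OF q r]) auto
  show "uf_act E \<phi> (uf_mult G q r) p = p"
    using uf_act_uf_mult[OF q r p _ maps_into] composition_rule fix_p by simp
  let ?D = "carrier G - stabilizer G (uf_translate \<phi>) p"
  have "visits (carrier G) (carrier G) (mult G) r ?D = carrier G"
  proof -
    have "mult G g -` ?D \<inter> carrier G \<in> r" if g: "g \<in> carrier G" for g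
    proof -
      \<comment> \<open>\<open>?K\<close> is the left coset \<open>g\<inverse> St(p)\<close>.\<close>
      let ?K = "{h \<in> carrier G. uf_translate \<phi> h p = uf_translate \<phi> (inv g) p}"
      have "h \<in> ?K" if h: "h \<in> carrier G" "g \<otimes> h \<in> stabilizer G (uf_translate \<phi>) p" for h
      proof -
        have "uf_translate \<phi> (inv g) p = uf_translate \<phi> (inv g) (uf_translate \<phi> (g \<otimes> h) p)"
          using h by (simp add: stabilizer_def)
        also have "\<dots> = uf_translate \<phi> (inv g \<otimes> (g \<otimes> h)) p"
          using g h f(3) by (simp add: uf_translate_mult)
        also have "inv g \<otimes> (g \<otimes> h) = h"
          using g h by (simp add: inv_solve_left')
        finally show ?thesis using h by simp
      qed
      then have "carrier G - ?K \<subseteq> mult G g -` ?D \<inter> carrier G" using g by auto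
      moreover have "?K \<notin> r"
        using g by (intro fixing_uf_avoids_fibres[OF r p off fix_p(2)]
            ultrafilter_on_uf_translate[OF _ p]) simp
      then have "carrier G - ?K \<in> r" using ultrafilter_on_Diff_iff[OF r, of ?K] by blast
      ultimately show ?thesis using filter_on_mono[OF f(2)] by blast
    qed
    then show ?thesis by (auto simp: visits_def)
  qed
  then show "?D \<in> uf_mult G q r"
    using filter_on_space[OF f(1)] by (auto simp: uf_mult_def mem_uf_act_iff[OF f(1,2)])
qed

lemma not_isolated_in_orbit_iff:
  assumes p: "ultrafilter_on E p"
  shows "\<not> openin (subtopology (sc_topology E) (orbit G (uf_translate \<phi>) p)) {p}
    \<longleftrightarrow> (\<forall>A\<in>p. \<exists>g \<in> carrier G - stabilizer G (uf_translate \<phi>) p. A \<in> uf_translate \<phi> g p)"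
    (is "\<not> openin (subtopology _ ?O) {p} \<longleftrightarrow> ?R")
proof -
  interpret group G using group_hom group_hom.axioms(1) by auto
  have fp: "filter_on E p" using p by (simp add: ultrafilter_on_def)
  have "uf_translate \<phi> \<one> p \<in> ?O" unfolding orbit_def by blast
  then have pO: "p \<in> ?O" by (simp add: uf_translate_one[OF fp])
  have isolated: "openin (subtopology (sc_topology E) ?O) {p}
      \<longleftrightarrow> (\<exists>A\<in>p. ?O \<inter> sc_cl E A = {p})"
  proof
    assume "openin (subtopology (sc_topology E) ?O) {p}"
    then obtain U where U: "openin (sc_topology E) U" "{p} = U \<inter> ?O"
      unfolding openin_subtopology by blast
    then have "p \<in> U" by blast
    with U(1) obtain A where A: "p \<in> sc_cl E A" "sc_cl E A \<subseteq> U"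
      unfolding openin_sc_topology_iff by blast
    then have "?O \<inter> sc_cl E A = {p}" using U(2) pO by blast
    moreover have "A \<in> p" using A by (simp add: sc_cl_def)
    ultimately show "\<exists>A\<in>p. ?O \<inter> sc_cl E A = {p}" by blast
  next
    assume "\<exists>A\<in>p. ?O \<inter> sc_cl E A = {p}"
    then obtain A where A: "A \<in> p" "?O \<inter> sc_cl E A = {p}" ..
    then have "openin (sc_topology E) (sc_cl E A)"
      using filter_on_subset[OF fp] by (simp add: openin_sc_cl)
    then have "openin (subtopology (sc_topology E) ?O) (?O \<inter> sc_cl E A)"
      by (rule openin_subtopology_Int2)
    with A show "openin (subtopology (sc_topology E) ?O) {p}" by simp
  qed
  have meets_only: "?O \<inter> sc_cl E A = {p} \<longleftrightarrow>
      \<not> (\<exists>g \<in> carrier G - stabilizer G (uf_translate \<phi>) p. A \<in> uf_translate \<phi> g p)"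
    if "A \<in> p" for A
  proof -
    have translates: "?O \<inter> sc_cl E A = {uf_translate \<phi> g p | g. g \<in> carrier G \<and> A \<in> uf_translate \<phi> g p}"
      using ultrafilter_on_uf_translate[OF _ p] by (auto simp: orbit_def sc_cl_def stone_cech_def)
    have "p \<in> ?O \<inter> sc_cl E A"
      using that pO p by (simp add: sc_cl_def stone_cech_def)
    then have "?O \<inter> sc_cl E A = {p} \<longleftrightarrow> (\<forall>x \<in> ?O \<inter> sc_cl E A. x = p)" by blast
    also have "\<dots> \<longleftrightarrow> (\<forall>g \<in> carrier G. A \<in> uf_translate \<phi> g p \<longrightarrow> uf_translate \<phi> g p = p)"
      unfolding translates by blast
    also have "\<dots> \<longleftrightarrow>
        \<not> (\<exists>g \<in> carrier G - stabilizer G (uf_translate \<phi>) p. A \<in> uf_translate \<phi> g p)"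
      unfolding stabilizer_def by blast
    finally show ?thesis .
  qed
  have "openin (subtopology (sc_topology E) ?O) {p} \<longleftrightarrow> (\<exists>A\<in>p.
      \<not> (\<exists>g \<in> carrier G - stabilizer G (uf_translate \<phi>) p. A \<in> uf_translate \<phi> g p))"
    unfolding isolated by (intro bex_cong refl meets_only)
  then show ?thesis by blast
qed

end

section \<open>Recurrence and idempotents\<close>

theorem theorem4p1:
  fixes G :: "('a, 'm) monoid_scheme" and X :: "'b set" and \<phi> :: "'a \<Rightarrow> 'b \<Rightarrow> 'b"
    and p :: "'b set set"
  assumes "transitive_action G X \<phi>" and "infinite X" and "p \<in> sc_remainder X"
  shows "(\<not> openin (subtopology (sc_topology X) (orbit G (uf_translate \<phi>) p)) {p} \<longleftrightarrow>
           (\<exists>q \<in> sc_star (carrier G) (carrier G - stabilizer G (uf_translate \<phi>) p).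
              uf_act X \<phi> q p = p))
       \<and> ((\<exists>q \<in> sc_star (carrier G) (carrier G - stabilizer G (uf_translate \<phi>) p).
              uf_act X \<phi> q p = p) \<longleftrightarrow>
           (\<exists>\<epsilon> \<in> sc_star (carrier G) (carrier G - stabilizer G (uf_translate \<phi>) p).
              uf_mult G \<epsilon> \<epsilon> = \<epsilon> \<and> uf_act X \<phi> \<epsilon> p = p))"
proof -
  interpret transitive_action G X \<phi> by fact
  interpret group G using group_hom group_hom.axioms(1) by auto
  have p: "ultrafilter_on X p"
    using assms(3) by (simp add: sc_remainder_def stone_cech_def)
  then have fp: "filter_on X p" by (simp add: ultrafilter_on_def)
  let ?D = "carrier G - stabilizer G (uf_translate \<phi>) p"
  let ?iso = "openin (subtopology (sc_topology X) (orbit G (uf_translate \<phi>) p)) {p}"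
  let ?S = "{q. ultrafilter_on (carrier G) q \<and> ?D \<in> q \<and> uf_act X \<phi> q p = p}"
  have star_iff: "q \<in> sc_star (carrier G) ?D \<and> uf_act X \<phi> q p = p \<longleftrightarrow> q \<in> ?S" for q
    using fixing_uf_nonprincipal[OF _ p]
    by (auto simp: sc_star_def sc_remainder_def stone_cech_def)

  have recurrent: "?S \<noteq> {}" if "\<not> ?iso"
  proof -
    \<comment> \<open>An ultrafilter that extends this filter contains \<open>{g. A \<in> gp}\<close> for every \<open>A \<in> p\<close>.\<close>
    define F where "F = {Q. Q \<subseteq> carrier G \<and> (\<exists>A\<in>p. visits (carrier G) X \<phi> p A \<inter> ?D \<subseteq> Q)}"
    have "visits (carrier G) X \<phi> p A \<inter> ?D \<noteq> {}" if A: "A \<in> p" for A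
    proof -
      obtain g where "g \<in> ?D" "A \<in> uf_translate \<phi> g p"
        using \<open>\<not> ?iso\<close> A unfolding not_isolated_in_orbit_iff[OF p] by blast
      then have "g \<in> visits (carrier G) X \<phi> p A \<inter> ?D"
        by (simp add: mem_visits_iff[OF fp filter_on_subset[OF fp A]])
      then show ?thesis by blast
    qed
    then have empty: "{} \<notin> F" by (auto simp: F_def)
    have space: "carrier G \<in> F" using filter_on_space[OF fp] by (auto simp: F_def)
    have inter: "Q \<inter> R \<in> F" if QR: "Q \<in> F" "R \<in> F" for Q R
    proof -
      obtain A B where "A \<in> p" "B \<in> p" "visits (carrier G) X \<phi> p A \<inter> ?D \<subseteq> Q"
        "visits (carrier G) X \<phi> p B \<inter> ?D \<subseteq> R"
        using QR by (auto simp: F_def)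
      moreover from this have "A \<inter> B \<in> p" using filter_on_Int[OF fp] by blast
      ultimately have "\<exists>C\<in>p. visits (carrier G) X \<phi> p C \<inter> ?D \<subseteq> Q \<inter> R"
        using visits_Int[OF fp, of "carrier G" \<phi> A B] by (intro bexI[of _ "A \<inter> B"]) auto
      then show ?thesis using QR by (auto simp: F_def)
    qed
    have "filter_on (carrier G) F"
    proof (rule filter_onI)
      show "F \<subseteq> Pow (carrier G)" by (auto simp: F_def)
      show "R \<in> F" if "Q \<in> F" "Q \<subseteq> R" "R \<subseteq> carrier G" for Q R
        using that unfolding F_def by blast
    qed (fact empty space inter)+
    then obtain q where q: "ultrafilter_on (carrier G) q" "F \<subseteq> q"
      by (rule filter_extends_to_ultrafilter)
    have "?D \<in> F" using filter_on_space[OF fp] by (auto simp: F_def)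
    have "p \<subseteq> uf_act X \<phi> q p"
    proof
      fix A assume A: "A \<in> p"
      then have "visits (carrier G) X \<phi> p A \<in> F"
        using visits_subset by (fastforce simp: F_def)
      then show "A \<in> uf_act X \<phi> q p"
        using A q filter_on_subset[OF fp A]
        by (auto simp: mem_uf_act_iff[OF ultrafilter_on_imp_filter_on fp])
    qed
    then have "p = uf_act X \<phi> q p"
      using ultrafilter_on_uf_act[OF q(1) p maps_into]
      by (intro ultrafilter_on_maximal[OF p] ultrafilter_on_imp_filter_on)
    then show ?thesis using q \<open>?D \<in> F\<close> by auto
  qed

  have accumulates: "\<not> ?iso" if "q \<in> ?S" for q
    unfolding not_isolated_in_orbit_iff[OF p]
  proof
    fix A assume A: "A \<in> p"
    have q: "filter_on (carrier G) q" "?D \<in> q" "A \<in> uf_act X \<phi> q p"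
      using that A by (auto simp: ultrafilter_on_def)
    then have "visits (carrier G) X \<phi> p A \<inter> ?D \<in> q"
      using filter_on_Int[OF q(1)] by (simp add: mem_uf_act_iff[OF q(1) fp])
    then show "\<exists>g\<in>?D. A \<in> uf_translate \<phi> g p"
      using filter_on_nonempty[OF q(1)] filter_on_subset[OF fp A]
      by (fastforce simp: mem_visits_iff[OF fp])
  qed

  have idempotent: "\<exists>e\<in>?S. uf_mult G e e = e" if nonempty: "?S \<noteq> {}"
  proof -
    let ?T = "subtopology (sc_topology (carrier G)) ?S"
    have "closedin (sc_topology (carrier G))
        {q \<in> topspace (sc_topology (carrier G)). uf_act X \<phi> q p \<in> {p}}"
      using p continuous_map_uf_act[OF p maps_into]
      by (intro closedin_continuous_map_preimage[where Y = "sc_topology X"])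
        (auto simp: closedin_Hausdorff_sing_eq[OF Hausdorff_sc_topology]
          topspace_sc_topology stone_cech_def)
    then have "closedin (sc_topology (carrier G)) (sc_cl (carrier G) ?D
        \<inter> {q \<in> topspace (sc_topology (carrier G)). uf_act X \<phi> q p \<in> {p}})"
      using closedin_sc_cl[of ?D "carrier G"] by blast
    moreover have "sc_cl (carrier G) ?D
        \<inter> {q \<in> topspace (sc_topology (carrier G)). uf_act X \<phi> q p \<in> {p}} = ?S"
      by (auto simp: sc_cl_def topspace_sc_topology stone_cech_def)
    ultimately have closed: "closedin (sc_topology (carrier G)) ?S" by simp
    have top: "topspace ?T = ?S"
      using closedin_subset[OF closed] by (rule topspace_subtopology_subset)
    have mult: "uf_mult G q r \<in> ?S" if "q \<in> ?S" "r \<in> ?S" for q r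
      using that fixing_uf_mult[of q r p] p by blast
    obtain e where "e \<in> topspace ?T" "uf_mult G e e = e"
    proof (rule compact_right_topological_semigroup_idempotent[of ?T "uf_mult G"])
      show "compact_space ?T"
        using closed compact_sc_topology by (intro compact_space_subtopology closedin_compact_space)
      show "Hausdorff_space ?T"
        by (intro Hausdorff_space_subtopology Hausdorff_sc_topology)
      show "topspace ?T \<noteq> {}" unfolding top by (rule nonempty)
    next
      fix q r assume "q \<in> topspace ?T" "r \<in> topspace ?T"
      then show "uf_mult G q r \<in> topspace ?T" using mult unfolding top by blast
    next
      fix q r s assume "q \<in> topspace ?T" "r \<in> topspace ?T" "s \<in> topspace ?T"
      then have "ultrafilter_on (carrier G) q" "ultrafilter_on (carrier G) r"
        "ultrafilter_on (carrier G) s" unfolding top by auto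
      then show "uf_mult G (uf_mult G q r) s = uf_mult G q (uf_mult G r s)"
        unfolding uf_mult_def[of G _ s] uf_mult_def[of G q "uf_act _ _ _ _"]
        by (rule uf_act_uf_mult) (auto simp: m_assoc)
    next
      fix r assume r: "r \<in> topspace ?T"
      then have "ultrafilter_on (carrier G) r" unfolding top by auto
      then have "continuous_map (sc_topology (carrier G)) (sc_topology (carrier G))
          (\<lambda>q. uf_mult G q r)"
        unfolding uf_mult_def by (rule continuous_map_uf_act) auto
      then have "continuous_map ?T (sc_topology (carrier G)) (\<lambda>q. uf_mult G q r)"
        by (rule continuous_map_from_subtopology)
      then show "continuous_map ?T ?T (\<lambda>q. uf_mult G q r)"
      proof (rule continuous_map_into_subtopology)
        show "(\<lambda>q. uf_mult G q r) \<in> topspace ?T \<rightarrow> ?S"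
          using mult r unfolding top by blast
      qed
    qed
    then show ?thesis unfolding top by blast
  qed

  have ii: "(\<exists>q \<in> sc_star (carrier G) ?D. uf_act X \<phi> q p = p) \<longleftrightarrow> ?S \<noteq> {}"
    unfolding Bex_def star_iff by blast
  have iii: "(\<exists>e \<in> sc_star (carrier G) ?D. uf_mult G e e = e \<and> uf_act X \<phi> e p = p)
      \<longleftrightarrow> (\<exists>e \<in> ?S. uf_mult G e e = e)"
    unfolding Bex_def star_iff[symmetric] by blast
  have "\<not> ?iso \<longleftrightarrow> ?S \<noteq> {}" using recurrent accumulates by blast
  moreover have "?S \<noteq> {} \<longleftrightarrow> (\<exists>e \<in> ?S. uf_mult G e e = e)" using idempotent by blast
  ultimately show ?thesis unfolding ii iii by (rule conjI)
qed

end
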